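(* Let $G$ be a non-trivial finite abelian group. Let $p_1,\dots,p_m$ be the distinct prime factors of $\exp(G)$. When writing $G$ as a product of cyclic groups of prime power order (greater than $1$), all the occurring prime powers are powers of $p_1,\dots,p_m$; for $i=1,\dots,m$, let $n_i$ be the number of cyclic factors of $G$ in this decomposition whose order is a power of $p_i$. Then $$\mathfrak{s}(G)< 3\exp(G)\cdot \left(r(\mathbb{F}_{p_1}^{n_1})+\dots+r(\mathbb{F}_{p_m}^{n_m})\right).$$
   Context: For a finite abelian group $G$ (written additively), $\exp(G)$ denotes its exponent, i.e. the least common multiple of the orders of all elements of $G$. For a non-trivial finite abelian group $G$, the Erdős–Ginzburg–Ziv constant $\mathfrak{s}(G)$ is the smallest integer $s$ such that every sequence of $s$ (not necessarily distinct) elements of $G$ has a subsequence of length $\exp(G)$ whose elements sum to zero in $G$. A three-term arithmetic progression in $G$ is a set $\{x,y,z\}\subseteq G$ with $x,y,z$ distinct and $x+z=2y$. For a finite abelian group $G$, $r(G)$ denotes the largest size of a subset of $G$ that does not contain a three-term arithmetic progression. $\mathbb{F}_p^n$ is regarded as an additive group. *)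

theory Defs
  imports "HOL-Algebra.Algebra" "HOL-Number_Theory.Prime_Powers"
begin

text \<open>
  Abelian groups are represented by the library locale \<open>comm_group\<close>, hence in multiplicative
  notation: a zero sum is a product equal to the neutral element, and the condition
  $x + z = 2y$ becomes a condition on products.
\<close>

definition group_exp :: "('a, 'b) monoid_scheme \<Rightarrow> nat" where
  "group_exp G = (LCM x \<in> carrier G. group.ord G x)"

text \<open>A subsequence is given by its set of positions, so repeated elements are allowed.\<close>

definition egz_property :: "('a, 'b) monoid_scheme \<Rightarrow> nat \<Rightarrow> bool" where
  "egz_property G s \<longleftrightarrow>
     (\<forall>a \<in> {..<s} \<rightarrow> carrier G.
        \<exists>J \<subseteq> {..<s}. card J = group_exp G \<and> (\<Otimes>\<^bsub>G\<^esub>j\<in>J. a j) = \<one>\<^bsub>G\<^esub>)"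

definition egz_constant :: "('a, 'b) monoid_scheme \<Rightarrow> nat" where
  "egz_constant G = (LEAST s. egz_property G s)"

definition three_term_AP :: "('a, 'b) monoid_scheme \<Rightarrow> 'a set \<Rightarrow> bool" where
  "three_term_AP G A \<longleftrightarrow>
     (\<exists>x \<in> carrier G. \<exists>y \<in> carrier G. \<exists>z \<in> carrier G.
        A = {x, y, z} \<and> x \<noteq> y \<and> y \<noteq> z \<and> x \<noteq> z \<and> x \<otimes>\<^bsub>G\<^esub> z = y \<otimes>\<^bsub>G\<^esub> y)"

definition max_AP_free :: "('a, 'b) monoid_scheme \<Rightarrow> nat" where
  "max_AP_free G = Max {card S | S. S \<subseteq> carrier G \<and> \<not> (\<exists>A \<subseteq> S. three_term_AP G A)}"

text \<open>The additive group of the vector space of dimension \<open>n\<close> over the field with \<open>p\<close> elements.\<close>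

definition Fp_power :: "nat \<Rightarrow> nat \<Rightarrow> (nat \<Rightarrow> int) monoid" where
  "Fp_power p n = product_group {..<n} (\<lambda>_. integer_mod_group p)"

end

theory Submission
  imports Defs
begin

text \<open>
  For a sequence of length \<open>s\<close> in a group of odd prime exponent \<open>p\<close> without a zero-sum subsequence of
  length \<open>p\<close>, let \<open>m\<close> be the multiplicity function. If $(p-1)/2$ disjoint pairs of terms
  \<open>x \<noteq> z\<close> with $x + z = 2y$ were available for a term \<open>y\<close>, then these pairs and \<open>y\<close> itself would form a
  zero-sum subsequence of length \<open>p\<close>; so $\sum \min(m(x), m(z)) < p/2$ over all pairs \<open>{x, z}\<close> with
  midpoint \<open>y\<close>. Choose each value \<open>y\<close> independently with probability $m(y)/p$. The expected number of
  values is $s/p$, and the expected number of progressions with midpoint \<open>y\<close> is at most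
  $\frac{m(y)}{p} \cdot \frac{1}{p} \sum \min(m(x), m(z)) \le m(y)/(2p)$. Deleting one element of each
  progression gives $s/(2p) \le r$, whence $s \le 2pr \le 3(p-1)r$.

  If \<open>R\<close> bounds all the $r(\mathbb{F}_p^{n_p})$, the bound $3(L-1)R + 1$ for $L = \exp(G)$ then
  follows by peeling off one prime factor of \<open>L\<close> at a time, because
  $p \cdot 3(L/p - 1)R + 3(p-1)R = 3(L-1)R$.
\<close>

section \<open>Rounding of weights and the deletion method\<close>

text \<open>
  The left-hand side is affine in each single \<open>w v\<close>, so the weights can be rounded to 0 or 1 one
  after the other without decreasing it.
\<close>

lemma multilinear_rounding:
  fixes w :: "'a \<Rightarrow> real" and \<T> :: "'a set set"
  assumes V: "finite V" and w: "\<And>v. v \<in> V \<Longrightarrow> 0 \<le> w v \<and> w v \<le> 1"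
    and \<T>: "finite \<T>" "\<And>T. T \<in> \<T> \<Longrightarrow> T \<subseteq> V"
  shows "\<exists>S\<subseteq>V. (\<Sum>v\<in>V. w v) - (\<Sum>T\<in>\<T>. \<Prod>v\<in>T. w v) \<le> real (card S) - real (card {T \<in> \<T>. T \<subseteq> S})"
proof -
  define F where "F f = (\<Sum>v\<in>V. f v) - (\<Sum>T\<in>\<T>. \<Prod>v\<in>T. f v)" for f :: "'a \<Rightarrow> real"
  have affine: "F f = (1 - f u) * F (f(u := 0)) + f u * F (f(u := 1))" for f u
  proof -
    have "(\<Sum>v\<in>V. f v) = (\<Sum>v\<in>V. (1 - f u) * (f(u := 0)) v + f u * (f(u := 1)) v)"
      by (intro sum.cong refl) (auto simp: algebra_simps)
    moreover have "(\<Prod>v\<in>T. f v) = (1 - f u) * (\<Prod>v\<in>T. (f(u := 0)) v) + f u * (\<Prod>v\<in>T. (f(u := 1)) v)"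
      if "T \<in> \<T>" for T
    proof (cases "u \<in> T")
      case True
      have "finite T" using \<T>(2)[OF that] V finite_subset by blast
      then have "(\<Prod>v\<in>T. g v) = g u * (\<Prod>v\<in>T - {u}. g v)" for g :: "'a \<Rightarrow> real"
        using True by (simp add: prod.remove)
      from this[of f] this[of "f(u := 0)"] this[of "f(u := 1)"] show ?thesis
        by simp
    next
      case False
      then have "(\<Prod>v\<in>T. (f(u := t)) v) = (\<Prod>v\<in>T. f v)" for t
        by (intro prod.cong) auto
      then show ?thesis by (simp add: algebra_simps)
    qed
    then have "(\<Sum>T\<in>\<T>. \<Prod>v\<in>T. f v)
        = (\<Sum>T\<in>\<T>. (1 - f u) * (\<Prod>v\<in>T. (f(u := 0)) v) + f u * (\<Prod>v\<in>T. (f(u := 1)) v))"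
      by (intro sum.cong refl)
    ultimately show ?thesis
      unfolding F_def by (simp only: sum.distrib sum_distrib_left[symmetric]) (simp add: algebra_simps)
  qed
  \<comment> \<open>\<open>U\<close> is the set of coordinates already rounded; the others keep
    their weight from \<open>w\<close>. By \<open>affine\<close>, \<open>F f\<close> is a convex
    combination of the two values with \<open>f u\<close> replaced by 0 or 1, so one of them is at
    least \<open>F f\<close>.\<close>
  have "\<exists>f. (\<forall>v\<in>U. f v \<in> {0, 1}) \<and> (\<forall>v. v \<notin> U \<longrightarrow> f v = w v) \<and> F w \<le> F f"
    if "finite U" "U \<subseteq> V" for U
    using that
  proof (induction U rule: finite_induct)
    case empty
    then show ?case by auto
  next
    case (insert u U)
    then obtain f where f: "\<forall>v\<in>U. f v \<in> {0, 1}" "\<forall>v. v \<notin> U \<longrightarrow> f v = w v" "F w \<le> F f"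
      by auto
    have u: "0 \<le> f u" "f u \<le> 1" using f(2) insert.hyps insert.prems w by auto
    have "F f \<le> F (f(u := 0)) \<or> F f \<le> F (f(u := 1))"
    proof (rule ccontr)
      assume "\<not> ?thesis"
      then have "F (f(u := 0)) < F f" "F (f(u := 1)) < F f" by auto
      then have "(1 - f u) * F (f(u := 0)) + f u * F (f(u := 1)) < F f"
        using u by (intro convex_bound_lt) auto
      with affine[of f u] show False by simp
    qed
    then obtain t where t: "t \<in> {0, 1}" "F f \<le> F (f(u := t))" by auto
    have "F w \<le> F (f(u := t))" using f(3) t(2) by linarith
    moreover have "\<forall>v\<in>insert u U. (f(u := t)) v \<in> {0, 1}" "\<forall>v. v \<notin> insert u U \<longrightarrow> (f(u := t)) v = w v"
      using f t(1) by auto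
    ultimately show ?case by blast
  qed
  from this[of V] V obtain f where f: "\<forall>v\<in>V. f v \<in> {0, 1}" "F w \<le> F f" by auto
  define S where "S = {v \<in> V. f v = 1}"
  have "(\<Sum>v\<in>V. f v) = (\<Sum>v\<in>S. f v)"
    unfolding S_def by (rule sum.mono_neutral_right) (use V f in auto)
  also have "\<dots> = real (card S)" by (simp add: S_def)
  finally have 1: "(\<Sum>v\<in>V. f v) = real (card S)" .
  have p: "(\<Prod>v\<in>T. f v) = (if T \<subseteq> S then 1 else 0)" if "T \<in> \<T>" for T
  proof (cases "T \<subseteq> S")
    case True
    then show ?thesis by (auto simp: S_def intro!: prod.neutral)
  next
    case False
    then obtain v where "v \<in> T" "v \<notin> S" by auto
    moreover have "finite T" using \<T>(2)[OF that] V finite_subset by blast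
    ultimately show ?thesis using f \<T>(2)[OF that] False by (auto simp: S_def prod_zero_iff)
  qed
  have "(\<Sum>T\<in>\<T>. \<Prod>v\<in>T. f v) = (\<Sum>T\<in>\<T>. if T \<subseteq> S then 1 else 0)"
    by (intro sum.cong refl p)
  also have "\<dots> = real (card {T \<in> \<T>. T \<subseteq> S})"
    using \<T>(1) by (simp add: sum.If_cases Int_def)
  finally have "F f = real (card S) - real (card {T \<in> \<T>. T \<subseteq> S})"
    using 1 by (simp add: F_def)
  moreover have "S \<subseteq> V" by (auto simp: S_def)
  ultimately show ?thesis using f(2) by (auto simp: F_def)
qed

text \<open>Deleting one element from each member of \<open>\<T>\<close> inside the rounded set
  destroys all of them and costs at most as many elements as there are such members. This is the
  alteration argument with the expectation written out as a polynomial in the weights.\<close>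

lemma deletion_method:
  fixes w :: "'a \<Rightarrow> real" and \<T> :: "'a set set"
  assumes V: "finite V" and w: "\<And>v. v \<in> V \<Longrightarrow> 0 \<le> w v \<and> w v \<le> 1"
    and \<T>: "\<And>T. T \<in> \<T> \<Longrightarrow> T \<subseteq> V" "{} \<notin> \<T>"
  shows "\<exists>S\<subseteq>V. (\<forall>T\<in>\<T>. \<not> T \<subseteq> S) \<and> (\<Sum>v\<in>V. w v) - (\<Sum>T\<in>\<T>. \<Prod>v\<in>T. w v) \<le> real (card S)"
proof -
  have fin: "finite \<T>" by (rule finite_subset[of _ "Pow V"]) (use \<T>(1) V in auto)
  obtain S where S: "S \<subseteq> V"
    "(\<Sum>v\<in>V. w v) - (\<Sum>T\<in>\<T>. \<Prod>v\<in>T. w v) \<le> real (card S) - real (card {T \<in> \<T>. T \<subseteq> S})"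
    using multilinear_rounding[of V w \<T>] V w fin \<T>(1) by blast
  define B where "B = {T \<in> \<T>. T \<subseteq> S}"
  define e where "e T = (SOME v. v \<in> T)" for T :: "'a set"
  have e: "e T \<in> T" if "T \<in> \<T>" for T
    using that \<T>(2) unfolding e_def by (metis all_not_in_conv someI_ex)
  have "finite B" using fin by (simp add: B_def)
  then have "card (e ` B) \<le> card B" by (rule card_image_le)
  moreover have "card S - card (e ` B) \<le> card (S - e ` B)"
    using \<open>finite B\<close> by (intro diff_card_le_card_Diff) auto
  ultimately have "real (card S) - real (card B) \<le> real (card (S - e ` B))" by linarith
  moreover have "\<forall>T\<in>\<T>. \<not> T \<subseteq> S - e ` B" using e unfolding B_def by blast
  ultimately show ?thesis using S by (intro exI[of _ "S - e ` B"]) (auto simp: B_def)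
qed

section \<open>Zero sums in groups of prime exponent\<close>

text \<open>Pairs are unordered, so a progression counts once for each midpoint. The condition
  \<open>x \<noteq> z\<close> also keeps \<open>y\<close> out of the pair, by cancellation.\<close>

definition mirror_pairs :: "('a, 'b) monoid_scheme \<Rightarrow> 'a \<Rightarrow> 'a set set" where
  "mirror_pairs G y =
     {{x, z} | x z. x \<in> carrier G \<and> z \<in> carrier G \<and> x \<noteq> z \<and> x \<otimes>\<^bsub>G\<^esub> z = y \<otimes>\<^bsub>G\<^esub> y}"

definition occ :: "('i \<Rightarrow> 'a) \<Rightarrow> 'i set \<Rightarrow> 'a \<Rightarrow> nat" where
  "occ a I x = card {i \<in> I. a i = x}"

context comm_group
begin

text \<open>The partner of \<open>x\<close> must be \<open>2y - x\<close>. Hence the pairs around a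
  fixed midpoint are disjoint, and using up terms of one pair leaves the counts of the others
  intact.\<close>

lemma mirror_pairs_unique:
  assumes "y \<in> carrier G" "P \<in> mirror_pairs G y" "Q \<in> mirror_pairs G y" "x \<in> P" "x \<in> Q"
  shows "P = Q"
proof -
  have partner: "\<exists>z. P = {x, z} \<and> z \<in> carrier G \<and> x \<in> carrier G \<and> x \<otimes> z = y \<otimes> y"
    if P: "P \<in> mirror_pairs G y" and "x \<in> P" for P
  proof -
    obtain u v where uv: "P = {u, v}" "u \<in> carrier G" "v \<in> carrier G" "u \<otimes> v = y \<otimes> y"
      using P unfolding mirror_pairs_def by blast
    then have "v \<otimes> u = y \<otimes> y" "P = {v, u}" using m_comm by auto
    with uv \<open>x \<in> P\<close> show ?thesis by blast
  qed
  obtain z where z: "P = {x, z}" "z \<in> carrier G" "x \<in> carrier G" "x \<otimes> z = y \<otimes> y"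
    using partner[OF assms(2,4)] by blast
  obtain z' where z': "Q = {x, z'}" "z' \<in> carrier G" "x \<otimes> z' = y \<otimes> y"
    using partner[OF assms(3,5)] by blast
  have "z = z'" using z z' l_cancel by metis
  then show ?thesis using z(1) z'(1) by simp
qed

text \<open>The sum counts how many disjoint pairs of positions carry the values of mirror pairs.
  They are taken greedily, each contributing \<open>2y\<close>. Avoiding the value \<open>y\<close>
  leaves room for a later term equal to \<open>y\<close>.\<close>

lemma mirror_subsequence:
  assumes "finite (carrier G)" "y \<in> carrier G" "finite I" "a \<in> I \<rightarrow> carrier G"
    and "t \<le> (\<Sum>P\<in>mirror_pairs G y. Min (occ a I ` P))"
  shows "\<exists>J\<subseteq>I. card J = 2 * t \<and> (\<forall>j\<in>J. a j \<noteq> y) \<and> finprod G a J = y [^] (2 * t)"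
  using assms(3-5)
proof (induction t arbitrary: I)
  case 0
  then show ?case by (intro exI[of _ "{}"]) auto
next
  case (Suc t)
  have finP: "finite (mirror_pairs G y)"
    by (rule finite_subset[of _ "Pow (carrier G)"]) (use assms(1) in \<open>auto simp: mirror_pairs_def\<close>)
  have finp: "finite P" if "P \<in> mirror_pairs G y" for P
    using that by (auto simp: mirror_pairs_def)
  from Suc.prems(3) have "(\<Sum>P\<in>mirror_pairs G y. Min (occ a I ` P)) \<noteq> 0" by simp
  then obtain P where P: "P \<in> mirror_pairs G y" "Min (occ a I ` P) \<noteq> 0"
    by (meson sum.neutral)
  then obtain x z where xz: "P = {x, z}" "x \<in> carrier G" "z \<in> carrier G" "x \<noteq> z" "x \<otimes> z = y \<otimes> y"
    by (auto simp: mirror_pairs_def)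
  from P(2) xz have "occ a I x \<noteq> 0" "occ a I z \<noteq> 0" by auto
  then obtain i j where ij: "i \<in> I" "a i = x" "j \<in> I" "a j = z"
    unfolding occ_def by (metis (mono_tags, lifting) card.empty empty_Collect_eq)
  define I' where "I' = I - {i, j}"
  have sub: "I' \<subseteq> I" by (auto simp: I'_def)
  \<comment> \<open>Exactly one of \<open>i\<close>, \<open>j\<close> carries the value
    \<open>v\<close>, so both counts in \<open>P\<close> drop by one and so does their minimum; all
    other pairs are disjoint from \<open>P\<close> and unaffected.\<close>
  have occ_x: "occ a I v = Suc (occ a I' v)" if "v \<in> P" for v
  proof -
    have "\<exists>l\<in>{i, j}. {i \<in> I. a i = v} = insert l {i \<in> I'. a i = v} \<and> l \<notin> I'"
      using that ij xz by (auto simp: I'_def)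
    then show ?thesis using \<open>finite I\<close> by (auto simp: occ_def I'_def)
  qed
  have occ_v: "occ a I v = occ a I' v" if "v \<notin> P" for v
  proof -
    have "{i \<in> I. a i = v} = {i \<in> I'. a i = v}" using that ij xz by (auto simp: I'_def)
    then show ?thesis by (simp add: occ_def)
  qed
  have Min_P: "Min (occ a I ` P) = Suc (Min (occ a I' ` P))"
    using occ_x by (simp add: xz)
  have Min_Q: "Min (occ a I ` Q) = Min (occ a I' ` Q)" if "Q \<in> mirror_pairs G y - {P}" for Q
  proof -
    have "Q \<inter> P = {}" using that P(1) mirror_pairs_unique[OF assms(2)] by blast
    then have "occ a I ` Q = occ a I' ` Q" using occ_v by (intro image_cong) auto
    then show ?thesis by simp
  qed
  have "(\<Sum>Q\<in>mirror_pairs G y. Min (occ a I ` Q)) = Suc (\<Sum>Q\<in>mirror_pairs G y. Min (occ a I' ` Q))"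
    using Min_P Min_Q by (simp add: sum.remove[OF finP P(1)])
  with Suc.prems(3) have "t \<le> (\<Sum>Q\<in>mirror_pairs G y. Min (occ a I' ` Q))" by simp
  moreover have "finite I'" "a \<in> I' \<rightarrow> carrier G" using Suc.prems sub finite_subset by auto
  ultimately obtain J where J: "J \<subseteq> I'" "card J = 2 * t" "\<forall>j\<in>J. a j \<noteq> y" "finprod G a J = y [^] (2 * t)"
    using Suc.IH by blast
  have "finite J" "a \<in> J \<rightarrow> carrier G" using J(1) \<open>finite I'\<close> \<open>a \<in> I' \<rightarrow> carrier G\<close> finite_subset by auto
  have nin: "i \<notin> J" "j \<notin> J" "i \<noteq> j" using J(1) xz ij by (auto simp: I'_def)
  have "x \<noteq> y" "z \<noteq> y" using xz(2-5) assms(2) by (metis l_cancel, metis r_cancel)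
  have "finprod G a (insert i (insert j J)) = x \<otimes> (z \<otimes> y [^] (2 * t))"
    using nin ij xz J(4) \<open>finite J\<close> \<open>a \<in> J \<rightarrow> carrier G\<close> by (simp add: finprod_insert)
  also have "\<dots> = (y \<otimes> y) \<otimes> y [^] (2 * t)" using xz assms(2) by (simp add: m_assoc[symmetric])
  also have "\<dots> = y [^] (2 * Suc t)" using assms(2) by (simp add: m_ac)
  finally show ?case
    using nin J ij sub \<open>finite J\<close> \<open>x \<noteq> y\<close> \<open>z \<noteq> y\<close>
    by (intro exI[of _ "insert i (insert j J)"]) auto
qed

lemma card_le_max_AP_free:
  assumes "finite (carrier G)" "S \<subseteq> carrier G" "\<And>A. A \<subseteq> S \<Longrightarrow> \<not> three_term_AP G A"
  shows "card S \<le> max_AP_free G"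
proof -
  have "{card S | S. S \<subseteq> carrier G \<and> \<not> (\<exists>A \<subseteq> S. three_term_AP G A)} \<subseteq> card ` Pow (carrier G)"
    by auto
  then have "finite {card S | S. S \<subseteq> carrier G \<and> \<not> (\<exists>A \<subseteq> S. three_term_AP G A)}"
    using assms(1) by (meson finite_Pow_iff finite_imageI finite_subset)
  then show ?thesis unfolding max_AP_free_def by (intro Max_ge) (use assms in auto)
qed

lemma max_AP_free_pos:
  assumes "finite (carrier G)"
  shows "0 < max_AP_free G"
proof -
  have "card {\<one>} \<le> max_AP_free G"
    by (rule card_le_max_AP_free) (use assms in \<open>auto simp: three_term_AP_def\<close>)
  then show ?thesis by simp
qed

text \<open>Every progression is a pair together with a midpoint. One set may arise in several ways,
  for instance in exponent 3 where each of its elements is a midpoint; since weights are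
  nonnegative, overcounting only enlarges the right-hand side.\<close>

lemma weighted_AP_sum_le:
  fixes w :: "'a \<Rightarrow> real"
  assumes fin: "finite (carrier G)" and w: "\<And>x. x \<in> carrier G \<Longrightarrow> 0 \<le> w x"
  shows "(\<Sum>T | T \<subseteq> carrier G \<and> three_term_AP G T. \<Prod>v\<in>T. w v)
    \<le> (\<Sum>y\<in>carrier G. w y * (\<Sum>P\<in>mirror_pairs G y. \<Prod>v\<in>P. w v))"
proof -
  have sub: "P \<subseteq> carrier G" if "P \<in> mirror_pairs G y" for P y
    using that by (auto simp: mirror_pairs_def)
  have finP: "finite (mirror_pairs G y)" for y
    by (rule finite_subset[of _ "Pow (carrier G)"]) (use fin sub in auto)
  define \<S> where "\<S> = Sigma (carrier G) (mirror_pairs G)"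
  have "finite \<S>" unfolding \<S>_def using fin finP by auto
  have "{T. T \<subseteq> carrier G \<and> three_term_AP G T} \<subseteq> (\<lambda>(y, P). insert y P) ` \<S>"
  proof
    fix T assume "T \<in> {T. T \<subseteq> carrier G \<and> three_term_AP G T}"
    then obtain x y z where "x \<in> carrier G" "y \<in> carrier G" "z \<in> carrier G" "T = {x, y, z}" "x \<noteq> z"
      "x \<otimes> z = y \<otimes> y"
      unfolding three_term_AP_def by auto
    then have "(y, {x, z}) \<in> \<S>" "T = insert y {x, z}" by (auto simp: \<S>_def mirror_pairs_def)
    then show "T \<in> (\<lambda>(y, P). insert y P) ` \<S>" by force
  qed
  then have "(\<Sum>T | T \<subseteq> carrier G \<and> three_term_AP G T. \<Prod>v\<in>T. w v)
      \<le> (\<Sum>T\<in>(\<lambda>(y, P). insert y P) ` \<S>. \<Prod>v\<in>T. w v)"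
    using \<open>finite \<S>\<close> w by (intro sum_mono2) (auto simp: \<S>_def intro!: prod_nonneg dest: sub)
  also have "\<dots> \<le> (\<Sum>yP\<in>\<S>. \<Prod>v\<in>(\<lambda>(y, P). insert y P) yP. w v)"
    using \<open>finite \<S>\<close> w
    by (intro sum_image_le[of _ "\<lambda>T. \<Prod>v\<in>T. w v", unfolded o_def])
      (auto simp: \<S>_def intro!: prod_nonneg dest: sub)
  also have "\<dots> = (\<Sum>(y, P)\<in>\<S>. w y * (\<Prod>v\<in>P. w v))"
  proof (intro sum.cong refl, clarify)
    fix y P assume "(y, P) \<in> \<S>"
    then have "y \<notin> P" "finite P" by (auto simp: \<S>_def mirror_pairs_def)
    then show "(\<Prod>v\<in>insert y P. w v) = w y * (\<Prod>v\<in>P. w v)" by simp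
  qed
  also have "\<dots> = (\<Sum>y\<in>carrier G. w y * (\<Sum>P\<in>mirror_pairs G y. \<Prod>v\<in>P. w v))"
    unfolding \<S>_def using fin finP by (simp add: sum.Sigma[symmetric] sum_distrib_left)
  finally show ?thesis .
qed

lemma zero_sum_prime_exponent:
  fixes p :: nat
  assumes fin: "finite (carrier G)" and p: "Factorial_Ring.prime p" and exp: "\<And>x. x \<in> carrier G \<Longrightarrow> x [^] p = \<one>"
    and I: "finite I" "3 * (p - 1) * max_AP_free G < card I" and a: "a \<in> I \<rightarrow> carrier G"
  shows "\<exists>J\<subseteq>I. card J = p \<and> finprod G a J = \<one>"
proof (rule ccontr)
  assume neg: "\<not> ?thesis"
  have p0: "p > 0" "p \<ge> 2" using p prime_gt_0_nat prime_ge_2_nat by auto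
  have occ_less: "occ a I x < p" if "x \<in> carrier G" for x
  proof (rule ccontr)
    assume "\<not> ?thesis"
    then obtain J where J: "J \<subseteq> {i \<in> I. a i = x}" "card J = p"
      unfolding occ_def by (meson obtain_subset_with_card_n not_less)
    have "finprod G a J = finprod G (\<lambda>_. x) J" by (rule finprod_cong') (use J that in auto)
    also have "\<dots> = \<one>" using J that exp by (simp add: finprod_const)
    finally show False using neg J by blast
  qed
  have sum_occ: "(\<Sum>x\<in>carrier G. occ a I x) = card I"
    unfolding occ_def card_eq_sum by (rule sum.group) (use fin I a in auto)
  have pairs: "2 * (\<Sum>P\<in>mirror_pairs G y. Min (occ a I ` P)) < p"
    if y: "y \<in> carrier G" "occ a I y \<noteq> 0" and "odd p" for y
  proof (rule ccontr)
    assume "\<not> ?thesis"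
    then have "(p - 1) div 2 \<le> (\<Sum>P\<in>mirror_pairs G y. Min (occ a I ` P))" by linarith
    from mirror_subsequence[OF fin y(1) I(1) a this]
    obtain J where J: "J \<subseteq> I" "card J = p - 1" "\<forall>j\<in>J. a j \<noteq> y" "finprod G a J = y [^] (p - 1)"
      using \<open>odd p\<close> by auto
    \<comment> \<open>One more term \<open>y\<close> brings the length to \<open>p\<close>; its
      position lies outside \<open>J\<close> because \<open>J\<close> avoids the value
      \<open>y\<close>.\<close>
    obtain i where i: "i \<in> I" "a i = y"
      using y(2) unfolding occ_def by (metis (mono_tags, lifting) card.empty empty_Collect_eq)
    have "finite J" using J(1) I(1) finite_subset by blast
    have "finprod G a (insert i J) = y \<otimes> y [^] (p - 1)"
      using J i a y(1) \<open>finite J\<close> by (subst finprod_insert) auto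
    also have "\<dots> = y [^] p"
      using y(1) p0 by (metis Suc_diff_1 nat_pow_Suc2)
    finally show False
      using neg exp[OF y(1)] J i p0 \<open>finite J\<close> by (force intro: exI[of _ "insert i J"])
  qed
  \<comment> \<open>These are the selection probabilities. They are at most 1 by
    \<open>occ_less\<close>, since \<open>p\<close> equal terms would already have zero sum.\<close>
  define w where "w x = real (occ a I x) / real p" for x
  have w: "0 \<le> w x \<and> w x \<le> 1" if "x \<in> carrier G" for x
    using occ_less[OF that] by (simp add: w_def)
  have sum_w: "(\<Sum>x\<in>carrier G. w x) = real (card I) / real p"
    unfolding w_def sum_divide_distrib[symmetric] sum_occ[symmetric] by simp
  have pair_le: "(\<Prod>v\<in>P. w v) \<le> real (Min (occ a I ` P)) / real p" if P_in: "P \<in> mirror_pairs G y" for P y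
  proof -
    obtain x z where P: "P = {x, z}" "x \<noteq> z" "x \<in> carrier G" "z \<in> carrier G"
      using P_in unfolding mirror_pairs_def by auto
    have "(\<Prod>v\<in>P. w v) = w x * w z" using P by simp
    also have "\<dots> \<le> min (w x) (w z)"
      using w[OF P(3)] w[OF P(4)] by (auto simp: mult_left_le mult_left_le_one_le)
    also have "\<dots> = real (Min (occ a I ` P)) / real p"
      using p0 by (simp add: P w_def min_def divide_le_cancel)
    finally show ?thesis .
  qed
  define \<T> where "\<T> = {T. T \<subseteq> carrier G \<and> three_term_AP G T}"
  have T_sum: "(\<Sum>T\<in>\<T>. \<Prod>v\<in>T. w v) \<le> (\<Sum>y\<in>carrier G. w y * (\<Sum>P\<in>mirror_pairs G y. \<Prod>v\<in>P. w v))"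
    unfolding \<T>_def by (rule weighted_AP_sum_le) (use fin w in auto)
  obtain S where S: "S \<subseteq> carrier G" "\<forall>T\<in>\<T>. \<not> T \<subseteq> S"
    "(\<Sum>x\<in>carrier G. w x) - (\<Sum>T\<in>\<T>. \<Prod>v\<in>T. w v) \<le> real (card S)"
  proof -
    have "T \<subseteq> carrier G" if "T \<in> \<T>" for T using that by (simp add: \<T>_def)
    moreover have "{} \<notin> \<T>" by (auto simp: \<T>_def three_term_AP_def)
    ultimately show thesis using deletion_method[of "carrier G" w \<T>] fin w that by blast
  qed
  have "\<not> three_term_AP G A" if "A \<subseteq> S" for A
    using S(1,2) that unfolding \<T>_def by blast
  then have "card S \<le> max_AP_free G"
    using fin S(1) by (intro card_le_max_AP_free)
  with S(3) sum_w have main: "real (card I) / real p - (\<Sum>T\<in>\<T>. \<Prod>v\<in>T. w v) \<le> real (max_AP_free G)"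
    by linarith
  show False
  proof (cases "p = 2")
    case True
    \<comment> \<open>In exponent 2, \<open>x + z = 2y = 0 = 2x\<close> forces \<open>x = z\<close>,
      so there are no progressions and nothing has to be deleted.\<close>
    have "x = z" if "x \<in> carrier G" "z \<in> carrier G" "y \<in> carrier G" "x \<otimes> z = y \<otimes> y" for x y z
    proof -
      have sq: "v \<otimes> v = \<one>" if "v \<in> carrier G" for v
        using exp[OF that] that True by (simp add: numeral_2_eq_2)
      then have "x \<otimes> z = x \<otimes> x" using that by metis
      then show ?thesis using that(1,2) by (metis l_cancel)
    qed
    then have "\<T> = {}" unfolding \<T>_def three_term_AP_def by blast
    then have "real (card I) \<le> real (2 * max_AP_free G)" using main True by simp
    then show False using I(2) True by simp
  next
    case False
    then have "odd p" using p prime_odd_nat p0 by force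
    \<comment> \<open>The bound \<open>pairs\<close> covers only values that occur in the sequence;
      for the others the weight \<open>w y\<close> is 0.\<close>
    have "w y * (\<Sum>P\<in>mirror_pairs G y. \<Prod>v\<in>P. w v) \<le> w y * (1 / 2)" if y: "y \<in> carrier G" for y
    proof (cases "occ a I y = 0")
      case True
      then show ?thesis by (simp add: w_def)
    next
      case False
      have "(\<Sum>P\<in>mirror_pairs G y. \<Prod>v\<in>P. w v) \<le> (\<Sum>P\<in>mirror_pairs G y. real (Min (occ a I ` P)) / real p)"
        by (rule sum_mono) (rule pair_le)
      also have "\<dots> = real (\<Sum>P\<in>mirror_pairs G y. Min (occ a I ` P)) / real p"
        by (simp add: sum_divide_distrib)
      also have "\<dots> \<le> 1 / 2"
        using pairs[OF y False \<open>odd p\<close>] p0 by (simp add: field_simps del: of_nat_sum)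
      finally show ?thesis using w[OF y] by (intro mult_left_mono) auto
    qed
    then have "(\<Sum>y\<in>carrier G. w y * (\<Sum>P\<in>mirror_pairs G y. \<Prod>v\<in>P. w v)) \<le> (\<Sum>y\<in>carrier G. w y * (1 / 2))"
      by (rule sum_mono)
    also have "\<dots> = real (card I) / real p / 2" by (simp only: sum_distrib_right[symmetric] sum_w)
    finally have "real (card I) / real p / 2 \<le> real (max_AP_free G)" using main T_sum by linarith
    then have "real (card I) \<le> real (2 * p * max_AP_free G)" using p0 by (simp add: field_simps)
    then have "card I \<le> 2 * p * max_AP_free G" by linarith
    \<comment> \<open>This is the origin of the constant 3: \<open>2 * p \<le> 3 * (p - 1)\<close>
      holds exactly from \<open>p = 3\<close> on, which is why \<open>p = 2\<close> was treated
      separately.\<close>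
    also have "\<dots> \<le> 3 * (p - 1) * max_AP_free G"
      using p0 False by (intro mult_right_mono) auto
    finally show False using I(2) by simp
  qed
qed

end

section \<open>Zero sums of integer vectors and induction over prime factors\<close>

text \<open>
  Elements of $\prod_{i<k} \mathbb{Z}/q_i$ are represented by arbitrary integer vectors, which makes
  division of the coordinates by \<open>p\<close> available in the passage from \<open>G\<close> to a proper subgroup.
\<close>

definition zero_sum_dvd :: "nat \<Rightarrow> (nat \<Rightarrow> nat) \<Rightarrow> nat \<Rightarrow> nat \<Rightarrow> bool" where
  "zero_sum_dvd k q l s \<longleftrightarrow>
     (\<forall>(a :: nat \<Rightarrow> nat \<Rightarrow> int) I. finite I \<longrightarrow> s \<le> card I \<longrightarrow>
        (\<exists>J\<subseteq>I. card J = l \<and> (\<forall>i<k. int (q i) dvd (\<Sum>j\<in>J. a j i))))"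

lemma zero_sum_dvdD:
  fixes a :: "nat \<Rightarrow> nat \<Rightarrow> int"
  assumes "zero_sum_dvd k q l s" "finite I" "s \<le> card I"
  obtains J where "J \<subseteq> I" "card J = l" "\<And>i. i < k \<Longrightarrow> int (q i) dvd (\<Sum>j\<in>J. a j i)"
  using assms unfolding zero_sum_dvd_def by metis

lemma zero_sum_dvd_mono:
  assumes "zero_sum_dvd k q l s" "\<And>i. i < k \<Longrightarrow> q' i dvd q i"
  shows "zero_sum_dvd k q' l s"
  unfolding zero_sum_dvd_def
proof (intro allI impI)
  fix a :: "nat \<Rightarrow> nat \<Rightarrow> int" and I :: "nat set"
  assume "finite I" "s \<le> card I"
  then obtain J where "J \<subseteq> I" "card J = l" "\<And>i. i < k \<Longrightarrow> int (q i) dvd (\<Sum>j\<in>J. a j i)"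
    using zero_sum_dvdD[OF assms(1), of I a] by blast
  moreover from this have "\<And>i. i < k \<Longrightarrow> int (q' i) dvd (\<Sum>j\<in>J. a j i)"
    using assms(2) by (meson dvd_trans int_dvd_int_iff)
  ultimately show "\<exists>J\<subseteq>I. card J = l \<and> (\<forall>i<k. int (q' i) dvd (\<Sum>j\<in>J. a j i))" by blast
qed

text \<open>Blocks are extracted greedily: after the removal of \<open>t\<close> of them at least
  \<open>s\<close> positions remain, which suffices for one more. Hence there are
  \<open>t + 1\<close> blocks, indexed by \<open>{..t}\<close>.\<close>

lemma zero_sum_dvd_disjoint_blocks:
  fixes a :: "nat \<Rightarrow> nat \<Rightarrow> int"
  assumes "zero_sum_dvd k q p s" "finite I" "p * t + s \<le> card I"
  shows "\<exists>B. (\<forall>u\<le>t. B u \<subseteq> I \<and> card (B u) = p \<and> (\<forall>i<k. int (q i) dvd (\<Sum>j\<in>B u. a j i))) \<and>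
    disjoint_family_on B {..t}"
  using assms(2,3)
proof (induction t arbitrary: I)
  case 0
  from zero_sum_dvdD[OF assms(1) 0(1), of a] 0(2)
  obtain J where "J \<subseteq> I" "card J = p" "\<And>i. i < k \<Longrightarrow> int (q i) dvd (\<Sum>j\<in>J. a j i)" by auto
  then show ?case by (intro exI[of _ "\<lambda>_. J"]) (auto simp: disjoint_family_on_def)
next
  case (Suc t)
  from zero_sum_dvdD[OF assms(1) Suc.prems(1), of a] Suc.prems(2)
  obtain J where J: "J \<subseteq> I" "card J = p" "\<And>i. i < k \<Longrightarrow> int (q i) dvd (\<Sum>j\<in>J. a j i)" by auto
  have "finite J" using J(1) Suc.prems(1) finite_subset by blast
  then have "card (I - J) = card I - p" using J by (simp add: card_Diff_subset)
  then have "p * t + s \<le> card (I - J)" using Suc.prems(2) by simp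
  with Suc.IH[of "I - J"] Suc.prems(1) obtain B where
    B: "\<And>u. u \<le> t \<Longrightarrow> B u \<subseteq> I - J \<and> card (B u) = p \<and> (\<forall>i<k. int (q i) dvd (\<Sum>j\<in>B u. a j i))"
    and disj: "disjoint_family_on B {..t}"
    by auto
  have "disjoint_family_on (B(Suc t := J)) {..Suc t}"
    using disj B unfolding disjoint_family_on_def by (fastforce simp: le_Suc_eq)
  then show ?case
    using B J by (intro exI[of _ "B(Suc t := J)"]) (fastforce simp: le_Suc_eq)
qed

text \<open>In group terms, \<open>q\<close> describes a quotient and \<open>r\<close> the kernel.
  The block sums lie in the kernel; divided by \<open>q\<close> they form \<open>t + 1\<close> new
  vectors, and the \<open>l\<close> blocks selected among these unite to \<open>p * l\<close>
  terms.\<close>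

lemma zero_sum_dvd_mult:
  assumes "zero_sum_dvd k q p s" "zero_sum_dvd k r l (Suc t)" "\<And>i. i < k \<Longrightarrow> q i > 0" "p > 0"
  shows "zero_sum_dvd k (\<lambda>i. q i * r i) (p * l) (p * t + s)"
  unfolding zero_sum_dvd_def
proof (intro allI impI)
  fix a :: "nat \<Rightarrow> nat \<Rightarrow> int" and I :: "nat set"
  assume I: "finite I" "p * t + s \<le> card I"
  from zero_sum_dvd_disjoint_blocks[OF assms(1) this, of a] obtain B where
    B: "\<And>u. u \<le> t \<Longrightarrow> B u \<subseteq> I" "\<And>u. u \<le> t \<Longrightarrow> card (B u) = p"
      "\<And>u i. u \<le> t \<Longrightarrow> i < k \<Longrightarrow> int (q i) dvd (\<Sum>j\<in>B u. a j i)"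
    and disj: "disjoint_family_on B {..t}"
    by blast
  define c where "c u i = (\<Sum>j\<in>B u. a j i) div int (q i)" for u i
  have "Suc t \<le> card {..t}" by simp
  from zero_sum_dvdD[OF assms(2) _ this, of c] obtain U where
    U: "U \<subseteq> {..t}" "card U = l" "\<And>i. i < k \<Longrightarrow> int (r i) dvd (\<Sum>u\<in>U. c u i)"
    by auto
  have finU: "finite U" using U(1) finite_subset by blast
  have finB: "finite (B u)" if "u \<in> U" for u using that U(1) B(1) I(1) finite_subset by blast
  have disjU: "\<forall>u\<in>U. \<forall>v\<in>U. u \<noteq> v \<longrightarrow> B u \<inter> B v = {}"
    using disj U(1) by (auto simp: disjoint_family_on_def)
  have "card (\<Union>(B ` U)) = (\<Sum>u\<in>U. card (B u))"
    using finU finB disjU by (intro card_UN_disjoint) auto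
  also have "\<dots> = (\<Sum>u\<in>U. p)" using U(1) B(2) by (intro sum.cong) auto
  finally have "card (\<Union>(B ` U)) = p * l" using U(2) by simp
  moreover have "int (q i * r i) dvd (\<Sum>j\<in>\<Union>(B ` U). a j i)" if i: "i < k" for i
  proof -
    have "(\<Sum>j\<in>\<Union>(B ` U). a j i) = (\<Sum>u\<in>U. \<Sum>j\<in>B u. a j i)"
      using finU finB disjU by (intro sum.UNION_disjoint) auto
    also have "\<dots> = (\<Sum>u\<in>U. int (q i) * c u i)"
      using U(1) B(3) i by (intro sum.cong) (auto simp: c_def)
    also have "\<dots> = int (q i) * (\<Sum>u\<in>U. c u i)" by (simp add: sum_distrib_left)
    finally show ?thesis using U(3)[OF i] by simp
  qed
  moreover have "\<Union>(B ` U) \<subseteq> I" using U(1) B(1) by auto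
  ultimately show "\<exists>J\<subseteq>I. card J = p * l \<and> (\<forall>i<k. int (q i * r i) dvd (\<Sum>j\<in>J. a j i))"
    by blast
qed

text \<open>Strong induction on \<open>L\<close>, splitting off one prime at a time with
  \<open>zero_sum_dvd_mult\<close>. A bound \<open>R\<close> common to all primes is what makes the
  two estimates add up to one of the same shape.\<close>

lemma zero_sum_dvd_of_primes:
  fixes L R :: nat
  assumes "L > 0" "\<And>i. i < k \<Longrightarrow> q i dvd L"
    and "\<And>p. Factorial_Ring.prime p \<Longrightarrow> p dvd L \<Longrightarrow>
      zero_sum_dvd k (\<lambda>i. if p dvd q i then p else 1) p (3 * (p - 1) * R + 1)"
  shows "zero_sum_dvd k q L (3 * (L - 1) * R + 1)"
  using assms
proof (induction L arbitrary: q rule: less_induct)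
  case (less L)
  show ?case
  proof (cases "L = 1")
    case True
    \<comment> \<open>For \<open>L = 1\<close> all moduli are 1, so any single position will
      do.\<close>
    have "\<exists>J\<subseteq>I. card J = 1" if "1 \<le> card I" for I :: "nat set"
      using that by (metis obtain_subset_with_card_n)
    then show ?thesis using True less.prems(2) by (fastforce simp: zero_sum_dvd_def)
  next
    case False
    then obtain p where p: "Factorial_Ring.prime p" "p dvd L" using prime_factor_nat by blast
    then obtain L' where L': "L = p * L'" by blast
    have p2: "p \<ge> 2" using p(1) prime_ge_2_nat by blast
    have "L' > 0" "L' < L" using less.prems(1) L' p2 by auto
    \<comment> \<open>\<open>q1\<close> describes the quotient modulo \<open>p\<close>, trivial in
      coordinates where \<open>p\<close> does not divide \<open>q i\<close>; \<open>q2\<close>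
      collects the remaining moduli, which divide \<open>L'\<close>.\<close>
    define q1 where "q1 i = (if p dvd q i then p else 1)" for i
    define q2 where "q2 i = (if p dvd q i then q i div p else q i)" for i
    have q: "q i = q1 i * q2 i" for i by (auto simp: q1_def q2_def)
    have q2_dvd: "q2 i dvd L'" if "i < k" for i
    proof (cases "p dvd q i")
      case True
      then have "p * q2 i dvd p * L'" using less.prems(2)[OF that] L' by (auto simp: q2_def)
      then show ?thesis using p2 by simp
    next
      case False
      then have "coprime p (q i)" using p(1) prime_imp_coprime by blast
      then show ?thesis
        using False less.prems(2)[OF that] L' by (simp add: q2_def coprime_commute coprime_dvd_mult_right_iff)
    qed
    have "zero_sum_dvd k q2 L' (3 * (L' - 1) * R + 1)"
    proof (rule less.IH)
      fix p' assume p': "Factorial_Ring.prime p'" "p' dvd L'"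
      then have "zero_sum_dvd k (\<lambda>i. if p' dvd q i then p' else 1) p' (3 * (p' - 1) * R + 1)"
        using L' by (intro less.prems(3)) auto
      \<comment> \<open>A prime dividing \<open>q2 i\<close> also divides \<open>q i\<close>, so the
        moduli for \<open>q2\<close> divide those for \<open>q\<close>.\<close>
      then show "zero_sum_dvd k (\<lambda>i. if p' dvd q2 i then p' else 1) p' (3 * (p' - 1) * R + 1)"
        by (rule zero_sum_dvd_mono) (auto simp: q[of _])
    qed (use \<open>L' > 0\<close> \<open>L' < L\<close> q2_dvd in auto)
    then have 2: "zero_sum_dvd k q2 L' (Suc (3 * (L' - 1) * R))" by simp
    have 1: "zero_sum_dvd k q1 p (3 * (p - 1) * R + 1)"
      unfolding q1_def by (rule less.prems(3)) (use p in auto)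
    have "zero_sum_dvd k (\<lambda>i. q1 i * q2 i) (p * L') (p * (3 * (L' - 1) * R) + (3 * (p - 1) * R + 1))"
      by (rule zero_sum_dvd_mult[OF 1 2]) (use p2 in \<open>auto simp: q1_def\<close>)
    moreover have "p * (3 * (L' - 1) * R) + (3 * (p - 1) * R + 1) = 3 * (L - 1) * R + 1"
    proof -
      \<comment> \<open>Writing \<open>L'\<close> and \<open>p\<close> as successors removes the
        truncated subtractions.\<close>
      obtain m where "L' = Suc m" using \<open>L' > 0\<close> gr0_implies_Suc by blast
      moreover obtain v where "p = Suc v" using p2 by (cases p) auto
      ultimately show ?thesis by (simp add: L' algebra_simps)
    qed
    ultimately show ?thesis by (simp add: q[symmetric] L')
  qed
qed

section \<open>Passage between groups and integer vectors\<close>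

lemma comm_group_product_group:
  assumes "\<And>i. i \<in> I \<Longrightarrow> comm_group (G i)"
  shows "comm_group (product_group I G)"
proof -
  have "group (product_group I G)" using assms by (simp add: comm_group.axioms)
  then show ?thesis
    by (rule group.group_comm_groupI)
      (auto simp: PiE_iff intro!: restrict_ext comm_monoid.m_comm[OF comm_group.axioms(1)] assms)
qed

text \<open>This turns products in a group into coordinatewise integer sums. It serves with the
  identity on \<open>Fp_power\<close> and with the isomorphism from \<open>G\<close> to its cyclic
  decomposition.\<close>

lemma hom_product_finprod:
  assumes "comm_group G" "f \<in> hom G (product_group I (\<lambda>i. integer_mod_group (q i)))"
    and "finite J" "a \<in> J \<rightarrow> carrier G" "i \<in> I"
  shows "f (finprod G a J) i = (\<Sum>j\<in>J. f (a j) i) mod int (q i)"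
proof -
  interpret comm_group G by fact
  have H: "group (product_group I (\<lambda>i. integer_mod_group (q i)))" by simp
  have "f \<one>\<^bsub>G\<^esub> = \<one>\<^bsub>product_group I (\<lambda>i. integer_mod_group (q i))\<^esub>"
    using assms(2) H by (simp add: hom_one)
  then have f1: "f \<one>\<^bsub>G\<^esub> i = 0" using assms(5) by simp
  show ?thesis
    using assms(3,4)
  proof (induction J rule: finite_induct)
    case empty
    then show ?case using f1 by simp
  next
    case (insert j J)
    then have "f (finprod G a (insert j J)) i = (f (a j) i + f (finprod G a J) i) mod int (q i)"
      using assms(2,5) by (simp add: hom_mult)
    then show ?case using insert by (simp add: mod_add_right_eq)
  qed
qed

text \<open>Coordinates with modulus 1 impose no condition. Keeping only those where
  \<open>p\<close> divides \<open>q i\<close> gives a sequence in an elementary abelian group, to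
  which \<open>zero_sum_prime_exponent\<close> applies.\<close>

lemma zero_sum_dvd_Fp_power:
  assumes p: "Factorial_Ring.prime p"
  shows "zero_sum_dvd k (\<lambda>i. if p dvd q i then p else 1) p
    (3 * (p - 1) * max_AP_free (Fp_power p (card {i. i < k \<and> p dvd q i})) + 1)"
  unfolding zero_sum_dvd_def
proof (intro allI impI)
  fix a :: "nat \<Rightarrow> nat \<Rightarrow> int" and I :: "nat set"
  define N where "N = {i. i < k \<and> p dvd q i}"
  define K where "K = Fp_power p (card N)"
  assume I: "finite I"
    "3 * (p - 1) * max_AP_free (Fp_power p (card {i. i < k \<and> p dvd q i})) + 1 \<le> card I"
  have p0: "p > 0" using p prime_gt_0_nat by blast
  interpret comm_group K unfolding K_def Fp_power_def by (rule comm_group_product_group) auto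
  have carrier: "carrier K = (\<Pi>\<^sub>E i\<in>{..<card N}. {0..<int p})"
    using p0 by (simp add: K_def Fp_power_def carrier_integer_mod_group)
  have "finite N" by (simp add: N_def)
  then obtain e where e: "bij_betw e {..<card N} N"
    using ex_bij_betw_nat_finite atLeast0LessThan by metis
  \<comment> \<open>The vectors are restricted to the coordinates in \<open>N\<close>, renumbered by
    \<open>e\<close>, and reduced modulo \<open>p\<close>.\<close>
  define b where "b j = (\<lambda>v\<in>{..<card N}. a j (e v) mod int p)" for j
  have b: "b \<in> I \<rightarrow> carrier K" using p0 by (auto simp: b_def carrier)
  have id_hom: "(\<lambda>x. x) \<in> hom K (product_group {..<card N} (\<lambda>i. integer_mod_group p))"
    by (simp add: K_def Fp_power_def hom_def)
  have pow: "x [^]\<^bsub>K\<^esub> p = \<one>\<^bsub>K\<^esub>" if x: "x \<in> carrier K" for x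
  proof -
    have "x [^]\<^bsub>K\<^esub> p = finprod K (\<lambda>_. x) {..<p}" using x by (simp add: finprod_const)
    moreover from this have "x [^]\<^bsub>K\<^esub> p \<in> carrier K" using x by simp
    moreover have "finprod K (\<lambda>_. x) {..<p} v = 0" if "v < card N" for v
      using hom_product_finprod[OF comm_group_axioms id_hom, of "{..<p}" "\<lambda>_. x" v] x that by simp
    ultimately show ?thesis
      by (intro ext) (auto simp: carrier K_def Fp_power_def PiE_def extensional_def)
  qed
  have "finite (carrier K)" unfolding carrier by (intro finite_PiE) auto
  then obtain J where J: "J \<subseteq> I" "card J = p" "finprod K b J = \<one>\<^bsub>K\<^esub>"
    using zero_sum_prime_exponent[OF _ p pow I(1) _ b] I(2) by (auto simp: K_def N_def)
  have "finite J" using J(1) I(1) finite_subset by blast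
  have "int p dvd (\<Sum>j\<in>J. a j i)" if i: "i \<in> N" for i
  proof -
    have "i \<in> e ` {..<card N}" using i bij_betw_imp_surj_on[OF e] by simp
    then obtain v where v: "v < card N" "e v = i" by blast
    have "b \<in> J \<rightarrow> carrier K" using b J(1) by auto
    from hom_product_finprod[OF comm_group_axioms id_hom \<open>finite J\<close> this, of v] v J(3)
    have "0 = (\<Sum>j\<in>J. b j v) mod int p" by (simp add: K_def Fp_power_def)
    also have "\<dots> = (\<Sum>j\<in>J. a j i) mod int p" using v by (simp add: b_def mod_sum_eq)
    finally show ?thesis by (simp add: dvd_eq_mod_eq_0)
  qed
  then have "\<forall>i<k. int (if p dvd q i then p else 1) dvd (\<Sum>j\<in>J. a j i)"
    by (auto simp: N_def)
  with J show "\<exists>J\<subseteq>I. card J = p \<and> (\<forall>i<k. int (if p dvd q i then p else 1) dvd (\<Sum>j\<in>J. a j i))"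
    by blast
qed

section \<open>The bound for \<open>G\<close>\<close>

lemma (in group) pow_group_exp:
  assumes "x \<in> carrier G"
  shows "x [^] group_exp G = \<one>"
proof -
  have "ord x dvd group_exp G" unfolding group_exp_def using assms by (intro dvd_Lcm) auto
  then show ?thesis using assms pow_eq_id by simp
qed

theorem theorem1:
  fixes G :: "('a, 'b) monoid_scheme" and k :: nat and q :: "nat \<Rightarrow> nat" and n :: "nat \<Rightarrow> nat"
  assumes "comm_group G" and "finite (carrier G)" and "carrier G \<noteq> {\<one>\<^bsub>G\<^esub>}"
    and "\<And>i. i < k \<Longrightarrow> primepow (q i)"
    and "G \<cong> product_group {..<k} (\<lambda>i. integer_mod_group (q i))"
    and "\<And>p. p \<in> prime_factors (group_exp G) \<Longrightarrow> n p = card {i. i < k \<and> (\<exists>e. q i = p ^ e)}"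
  shows "egz_constant G
           < 3 * group_exp G * (\<Sum>p\<in>prime_factors (group_exp G). max_AP_free (Fp_power p (n p)))"
proof -
  interpret comm_group G by fact
  define L where "L = group_exp G"
  define H where "H = product_group {..<k} (\<lambda>i. integer_mod_group (q i))"
  define R where "R = (\<Sum>p\<in>prime_factors L. max_AP_free (Fp_power p (n p)))"
  interpret H: group H by (simp add: H_def)
  obtain h where h: "h \<in> iso G H" using assms(5) by (auto simp: is_iso_def H_def)
  then have hom: "h \<in> hom G H" and bij: "bij_betw h (carrier G) (carrier H)" by (auto simp: iso_def)
  have h1: "h \<one>\<^bsub>G\<^esub> = \<one>\<^bsub>H\<^esub>" using hom by (simp add: hom_one)
  have q2: "q i \<ge> 2" if "i < k" for i
    using assms(4)[OF that] primepow_gt_Suc_0 by force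
  have "L \<noteq> 0"
    unfolding L_def group_exp_def using assms(2) ord_ge_1 by (subst Lcm_0_iff) (auto dest: ord_ge_1)
  have "L \<noteq> 1"
  proof
    assume "L = 1"
    then have "x = \<one>\<^bsub>G\<^esub>" if "x \<in> carrier G" for x
      using pow_group_exp[OF that] that by (simp add: L_def)
    then show False using assms(3) by auto
  qed
  have q_dvd: "q i dvd L" if i: "i < k" for i
  proof -
    \<comment> \<open>The unit vector in coordinate \<open>i\<close> has order \<open>q i\<close>;
      its preimage under \<open>h\<close> is killed by \<open>L\<close>, which gives
      \<open>q i dvd L\<close>.\<close>
    define u where "u = (\<lambda>v\<in>{..<k}. if v = i then 1 else 0 :: int)"
    have u: "u \<in> carrier H"
      using q2 by (force simp: H_def u_def carrier_integer_mod_group)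
    then have "u \<in> h ` carrier G" using bij_betw_imp_surj_on[OF bij] by simp
    then obtain x where x: "x \<in> carrier G" "h x = u" by blast
    have "finprod G (\<lambda>_. x) {..<L} = \<one>\<^bsub>G\<^esub>"
      using pow_group_exp[OF x(1)] x by (simp add: finprod_const L_def)
    with hom_product_finprod[OF assms(1) hom[unfolded H_def], of "{..<L}" "\<lambda>_. x" i] x i h1
    have "int L mod int (q i) = 0" by (simp add: H_def u_def)
    then show ?thesis by (simp add: zmod_int[symmetric] dvd_eq_mod_eq_0)
  qed
  have primes: "zero_sum_dvd k (\<lambda>i. if p dvd q i then p else 1) p (3 * (p - 1) * R + 1)"
    if p: "Factorial_Ring.prime p" "p dvd L" for p
  proof -
    have pf: "p \<in> prime_factors L" using p \<open>L \<noteq> 0\<close> by (auto simp: prime_factors_dvd)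
    \<comment> \<open>This identifies the factors counted by \<open>n p\<close> with the coordinates
      surviving modulo \<open>p\<close>. The exponent 0 cannot occur because
      \<open>q i \<ge> 2\<close>.\<close>
    have "(\<exists>e. q i = p ^ e) \<longleftrightarrow> p dvd q i" if i: "i < k" for i
    proof
      assume "\<exists>e. q i = p ^ e"
      then obtain e where "q i = p ^ e" by blast
      moreover have "e \<noteq> 0" using q2[OF i] calculation by (cases e) auto
      ultimately show "p dvd q i" by simp
    next
      assume "p dvd q i"
      obtain p' e where "Factorial_Ring.prime p'" "q i = p' ^ e"
        using assms(4)[OF i] unfolding primepow_def by blast
      with \<open>p dvd q i\<close> p(1) show "\<exists>e. q i = p ^ e"
        by (metis prime_dvd_power primes_dvd_imp_eq)
    qed
    then have "{i. i < k \<and> (\<exists>e. q i = p ^ e)} = {i. i < k \<and> p dvd q i}" by blast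
    then have "n p = card {i. i < k \<and> p dvd q i}"
      using assms(6)[OF pf[unfolded L_def]] by simp
    then have "zero_sum_dvd k (\<lambda>i. if p dvd q i then p else 1) p
        (3 * (p - 1) * max_AP_free (Fp_power p (n p)) + 1)"
      using zero_sum_dvd_Fp_power[OF p(1)] by simp
    moreover have "max_AP_free (Fp_power p (n p)) \<le> R"
      unfolding R_def using pf by (intro member_le_sum) auto
    then have "3 * (p - 1) * max_AP_free (Fp_power p (n p)) + 1 \<le> 3 * (p - 1) * R + 1" by simp
    ultimately show ?thesis unfolding zero_sum_dvd_def using le_trans by blast
  qed
  have zs: "zero_sum_dvd k q L (3 * (L - 1) * R + 1)"
    by (rule zero_sum_dvd_of_primes[OF _ q_dvd primes]) (use \<open>L \<noteq> 0\<close> in simp)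
  have "egz_property G (3 * (L - 1) * R + 1)"
    unfolding egz_property_def L_def[symmetric]
  proof
    fix a assume a: "a \<in> {..<3 * (L - 1) * R + 1} \<rightarrow> carrier G"
    \<comment> \<open>The coordinates of \<open>h (a j)\<close>, read as integers, are the vectors
      to which \<open>zs\<close> is applied.\<close>
    obtain J where J: "J \<subseteq> {..<3 * (L - 1) * R + 1}" "card J = L"
      "\<And>i. i < k \<Longrightarrow> int (q i) dvd (\<Sum>j\<in>J. h (a j) i)"
      by (rule zero_sum_dvdD[OF zs, of "{..<3 * (L - 1) * R + 1}" "\<lambda>j i. h (a j) i"]) auto
    have aJ: "a \<in> J \<rightarrow> carrier G" "finite J" using a J(1) finite_subset by auto
    have "h (finprod G a J) i = 0" if "i < k" for i
      using hom_product_finprod[OF assms(1) hom[unfolded H_def] aJ(2,1), of i] J(3) that by simp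
    moreover have "h (finprod G a J) \<in> carrier H" using aJ hom by (simp add: hom_in_carrier)
    ultimately have "h (finprod G a J) = \<one>\<^bsub>H\<^esub>"
      by (intro ext) (auto simp: H_def PiE_def extensional_def)
    then have "finprod G a J = \<one>\<^bsub>G\<^esub>"
      using h1 bij aJ by (metis bij_betw_def finprod_closed inj_onD one_closed)
    with J show "\<exists>J\<subseteq>{..<3 * (L - 1) * R + 1}. card J = L \<and> finprod G a J = \<one>\<^bsub>G\<^esub>" by blast
  qed
  then have "egz_constant G \<le> 3 * (L - 1) * R + 1" unfolding egz_constant_def by (rule Least_le)
  \<comment> \<open>Positivity makes the final inequality strict: the two sides differ by
    \<open>3 * R - 1\<close>.\<close>
  moreover have "R > 0"
  proof -
    obtain p where p: "Factorial_Ring.prime p" "p dvd L" using \<open>L \<noteq> 1\<close> prime_factor_nat by blast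
    then have pf: "p \<in> prime_factors L" using \<open>L \<noteq> 0\<close> by (auto simp: prime_factors_dvd)
    interpret K: comm_group "Fp_power p (n p)"
      unfolding Fp_power_def by (rule comm_group_product_group) auto
    have "finite (carrier (Fp_power p (n p)))"
      using p(1) prime_gt_0_nat by (auto simp: Fp_power_def carrier_integer_mod_group intro!: finite_PiE)
    then have "0 < max_AP_free (Fp_power p (n p))" by (rule K.max_AP_free_pos)
    also have "\<dots> \<le> R" unfolding R_def using pf by (intro member_le_sum) auto
    finally show ?thesis .
  qed
  moreover have "3 * (L - 1) * R + 1 < 3 * L * R" if "R > 0"
  proof -
    obtain m where "L = Suc m" using \<open>L \<noteq> 0\<close> not0_implies_Suc by blast
    with that show ?thesis by (simp add: algebra_simps)
  qed
  ultimately show ?thesis unfolding R_def L_def by linarith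
qed

end
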